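(* Let $G$ be a graph with $\delta(G) \ge (1-d)v(G)$ where $d=\frac{7 - \sqrt{21}}{14}$. Then $w_G(T)\ge 0$ for every triangle $T\in \mathcal{K}_3(G)$.
   Context: $\mathcal{K}_\ell(G)$ is the set of cliques on $\ell$ vertices of $G$; for a vertex set $S$, $\mathcal{K}_\ell(G,S)$ is the set of those containing $S$. An ordered $r$-clique is a tuple $(v_1,\ldots,v_r)$ of distinct vertices spanning a clique; $\mathcal{OK}_r(G)$ is the set of these. For $(v_1,\ldots,v_r)\in\mathcal{OK}_r(G)$, $r\in\{2,3,4\}$, define $W(v_1,\ldots,v_r)=\prod_{i=2}^r \frac{1}{|\mathcal{K}_{i+1}(G,\{v_1,\ldots,v_i\})|}$. For $K\in\mathcal{K}_5(G)$ and $e\in E(K)$, the edge-gadget $\psi_{K,e}$ is the function on triangles $T$ of $G$ equal to $+\frac13$ if $T\subseteq K$ and $|e\cap V(T)|\in\{0,2\}$, $-\frac16$ if $T\subseteq K$ and $|e\cap V(T)|=1$, and $0$ otherwise. For $K=(v_1,\ldots,v_5)\in\mathcal{OK}_5(G)$ let $\psi_K(T)=\psi_{G[\{v_1,\ldots,v_5\}],v_1v_2}(T)$. Define $w_G(T)=\frac12\sum_{K=(v_1,\ldots,v_5)\in\mathcal{OK}_5(G)} W(v_1,\ldots,v_4)\,\psi_K(T)$. *)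

theory Defs
  imports Complex_Main
begin

definition simple_graph :: "'a set \<Rightarrow> 'a set set \<Rightarrow> bool" where
  "simple_graph V E \<longleftrightarrow> finite V \<and> E \<subseteq> {e. e \<subseteq> V \<and> card e = 2}"

definition degree :: "'a set set \<Rightarrow> 'a \<Rightarrow> nat" where
  "degree E v = card {e \<in> E. v \<in> e}"

text \<open>Unspecified for the graph without vertices, which has no triangles.\<close>

definition min_degree :: "'a set \<Rightarrow> 'a set set \<Rightarrow> nat" where
  "min_degree V E = Min (degree E ` V)"

text \<open>A clique is identified with its vertex set.\<close>

definition cliques :: "'a set \<Rightarrow> 'a set set \<Rightarrow> nat \<Rightarrow> 'a set set" where
  "cliques V E l =
    {K. K \<subseteq> V \<and> card K = l \<and> (\<forall>u\<in>K. \<forall>v\<in>K. u \<noteq> v \<longrightarrow> {u, v} \<in> E)}"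

definition cliques_containing :: "'a set \<Rightarrow> 'a set set \<Rightarrow> nat \<Rightarrow> 'a set \<Rightarrow> 'a set set" where
  "cliques_containing V E l S = {K \<in> cliques V E l. S \<subseteq> K}"

definition ordered_cliques :: "'a set \<Rightarrow> 'a set set \<Rightarrow> nat \<Rightarrow> 'a list set" where
  "ordered_cliques V E r = {vs. length vs = r \<and> distinct vs \<and> set vs \<in> cliques V E r}"

text \<open>
  The list \<open>vs\<close> stands for the tuple $(v_1, \ldots, v_r)$, so \<open>set (take i vs)\<close> is
  $\{v_1, \ldots, v_i\}$. A factor may be \<open>1 / 0 = 0\<close> in general, but never when
  \<open>vs\<close> is an initial segment, of length at most 4, of an ordered 5-clique.
\<close>

definition clique_weight :: "'a set \<Rightarrow> 'a set set \<Rightarrow> 'a list \<Rightarrow> real" where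
  "clique_weight V E vs =
    (\<Prod>i = 2..length vs. 1 / real (card (cliques_containing V E (i + 1) (set (take i vs)))))"

text \<open>Meaningful when \<open>K\<close> is a 5-clique, \<open>e\<close> an edge of \<open>K\<close> and \<open>T\<close> a triangle.\<close>

definition edge_gadget :: "'a set \<Rightarrow> 'a set \<Rightarrow> 'a set \<Rightarrow> real" where
  "edge_gadget K e T =
    (if T \<subseteq> K \<and> card (e \<inter> T) \<in> {0, 2} then 1/3
     else if T \<subseteq> K \<and> card (e \<inter> T) = 1 then - 1/6
     else 0)"

definition ordered_clique_gadget :: "'a list \<Rightarrow> 'a set \<Rightarrow> real" where
  "ordered_clique_gadget vs T = edge_gadget (set vs) {vs ! 0, vs ! 1} T"

definition triangle_weight :: "'a set \<Rightarrow> 'a set set \<Rightarrow> 'a set \<Rightarrow> real" where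
  "triangle_weight V E T =
    1/2 * (\<Sum>vs \<in> ordered_cliques V E 5.
      clique_weight V E (take 4 vs) * ordered_clique_gadget vs T)"

end

theory Submission
  imports Defs "HOL-Combinatorics.Multiset_Permutations"
begin

text \<open>
  The weight $w_G(T)$ splits over the 5-cliques $K \supseteq T$, and the contribution of every
  such $K = T \cup \{a, b\}$ is already nonnegative. Write $D(S)$ for the proportion of
  vertices adjacent to all of $S$. Up to a positive factor the contribution of $K$ is a sum, over
  the edges $xy$ of $T$ and the two orders of $a, b$, of expressions in which the only possibly
  negative terms are multiples of $1/D(xy) - \frac12(1/D(xa) + 1/D(ya))$ and its analogues for
  $ab$ in place of $xy$. Since a vertex misses at most a proportion $d$ of the others, $D(xya)$
  is at least $D(xy) - d$, all $D(pq)$ are at least $c = 1 - 2d$, and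
  $D(xyab) \ge D(xy) + D(ab) - 1$. Subject to these constraints, the worst case is
  $D(xy) = D(ab) = 1 - d$ and $D(xya) = D(xyab) = c$, where the bound reads
  $3d(1-d) \le c^2$: equality for the root $d$ of $7d^2 - 7d + 1$.
\<close>

section \<open>Real inequalities at the critical density\<close>

context
  fixes g c d k :: real
  assumes g: "7*g^2 - 7*g + 1 = 0" "9/11 \<le> g" "g < 1"
    and c_def: "c = 2*g - 1" and d_def: "d = 1 - g" and k_def: "k = 1/(3*c*g^2)"
begin

text \<open>\<open>c^2 = 3*g*d\<close> is the quadratic for \<open>g\<close> rewritten; it is what
  makes the extremal configuration tight. \<open>k\<close> is half the slope of the tangent in the
  next bound.\<close>

lemma constants:
  "0 < c" "0 < d" "0 < k" "c < g" "d < c" "c^2 = 3*g*d" "3*c*g^2*k = 1"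
  using g unfolding c_def d_def k_def by (auto simp: power2_eq_square algebra_simps)

text \<open>
  For \<open>r \<le> g\<close> this replaces a concave function of \<open>r\<close> by its tangent at \<open>r = g\<close>; for
  \<open>r > g\<close> the bound is the value at \<open>g\<close>.
\<close>

lemma gadget_loss_bound:
  assumes r: "c \<le> r" and u: "r - d \<le> u" and m: "u \<le> m" "c \<le> m"
  shows "(1/m - 1/r)/u \<le> k*(2 * min r g - 1)"
proof -
  note cs = constants
  have pos: "r > 0" "u > 0" "m > 0" "r-d > 0" using r u m cs by auto
  show ?thesis
  proof (cases "r \<le> g")
    case True
    have "(1/m - 1/r)/u \<le> (1/c - 1/r)/u"
      using m pos cs by (intro divide_right_mono diff_right_mono divide_left_mono) auto
    also have "\<dots> \<le> (1/c - 1/r)/(r-d)"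
      using u pos cs r by (intro divide_left_mono mult_pos_pos) (auto simp: divide_simps)
    also have "\<dots> = (r-c)/(c*(r*(r-d)))" using pos cs by (simp add: divide_simps)
    also have "\<dots> \<le> (2*r-1)/(c*(3*g^2))"
    proof -
      \<comment> \<open>The double root at \<open>g\<close> is the tangency; the identity holds
        modulo the quadratic for \<open>g\<close>.\<close>
      have "r*(r-d)*(2*r-1) - 3*g^2*(r-c) = (r-g)^2*(2*r+3*c)"
        unfolding c_def d_def using g(1) by algebra
      then have "3*g^2*(r-c) \<le> r*(r-d)*(2*r-1)" using pos cs
        by (smt (verit) mult_nonneg_nonneg zero_le_power2)
      then have "(r-c)/(r*(r-d)) \<le> (2*r-1)/(3*g^2)"
        using pos cs by (simp add: divide_simps mult_ac)
      then show ?thesis using divide_right_mono[of "(r-c)/(r*(r-d))" "(2*r-1)/(3*g^2)" c] cs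
        by (simp add: mult_ac)
    qed
    also have "\<dots> = k*(2*r-1)" by (simp add: k_def)
    finally show ?thesis using True by (simp add: min_def)
  next
    case False
    \<comment> \<open>Now \<open>u \<ge> r - d > c\<close>, so \<open>u\<close> is the better lower
      bound for \<open>m\<close>; the resulting bound decreases in \<open>r\<close>.\<close>
    have "(1/m - 1/r)/u \<le> (1/u - 1/r)/u"
      using m pos by (intro divide_right_mono diff_right_mono divide_left_mono) auto
    also have "\<dots> \<le> (1/(r-d) - 1/r)/(r-d)"
    proof -
      have "1/u \<le> 1/(r-d)" using u pos by (intro divide_left_mono) auto
      moreover have "0 \<le> 1/(r-d) - 1/r" using pos cs by (simp add: divide_simps)
      ultimately show ?thesis using u pos by (intro frac_le) auto
    qed
    also have "\<dots> = d/(r*(r-d)^2)"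
      using pos by (simp add: divide_simps power2_eq_square)
    also have "\<dots> \<le> d/(g*c^2)"
      using False pos cs by (intro divide_left_mono mult_mono power_mono mult_pos_pos)
        (auto simp: c_def d_def)
    also have "\<dots> = k*(2*g-1)" using cs by (simp add: k_def c_def[symmetric] power2_eq_square)
    finally show ?thesis using False by (simp add: min_def)
  qed
qed

section \<open>Balancing gain and loss at an edge of the triangle\<close>

lemma linear_factor_bounds:
  fixes s \<rho> F G :: real
  assumes s: "c \<le> s" "s \<le> 1" and \<rho>: "c \<le> \<rho>" "\<rho> \<le> g"
    and F: "F = s + \<rho> - 1" and G: "G = k*(2*\<rho>-1)"
  shows "0 < F" "0 < G" "G \<le> 1"
proof -
  \<comment> \<open>Both \<open>F\<close> and \<open>2*\<rho> - 1\<close> are at least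
    \<open>2*c - 1 = 4*g - 3\<close>, which is then positive.\<close>
  have "11*g \<ge> 9" using g by simp
  then show "0 < F" "0 < G" using constants s \<rho> F G unfolding c_def by auto
  have "G \<le> k*c" unfolding G using constants \<rho> by (intro mult_left_mono) (auto simp: c_def)
  also have "\<dots> = 1/(3*g^2)" using constants by (simp add: k_def)
  also have "\<dots> \<le> 1" 
  proof -
    have "1 \<le> 3*g^2" using g by (auto simp: algebra_simps)
    then show ?thesis by (simp add: divide_simps)
  qed
  finally show "G \<le> 1" .
qed

text \<open>Since \<open>Y = s^2*(1/c - 1/s)\<close>, the tangent bound at \<open>r = s\<close>
  controls \<open>Y\<close>; what remains is tight at \<open>s = g\<close>.\<close>

lemma loss_balance_small_base:
  assumes s: "c \<le> s" "s \<le> g" and \<rho>: "c \<le> \<rho>" "\<rho> \<le> g"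
    and F: "F = s + \<rho> - 1" and G: "G = k*(2*\<rho>-1)" and Y: "Y = s*(s-c)/c"
    and \<tau>: "\<tau> = s - d"
  shows "Y*(\<tau>+F) \<le> \<tau>*F - s^2*\<tau>^2*G"
proof -
  note cs = constants
  have fg: "0 < F" "0 < G" using linear_factor_bounds[of s \<rho> F G] assms g by auto
  have pos: "0 < \<tau>" "0 < s" using cs s \<tau> by auto
  have "(1/c - 1/s)/\<tau> \<le> k*(2*s-1)"
    using gadget_loss_bound[of s \<tau> c] s cs by (auto simp: \<tau> c_def d_def min_def)
  then have "s^2*\<tau>*((1/c - 1/s)/\<tau>) \<le> s^2*\<tau>*(k*(2*s-1))"
    using pos by (intro mult_left_mono) auto
  also have "s^2*\<tau>*((1/c - 1/s)/\<tau>) = Y"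
    using pos cs by (simp add: Y field_simps power2_eq_square)
  finally have Yle: "Y \<le> s^2*\<tau>*(k*(2*s-1))" .
  have s1: "0 < 2*s-1" "0 < 2*\<rho>-1" using s \<rho> g unfolding c_def by auto
  \<comment> \<open>Inserting the bound on \<open>Y\<close> and dividing by \<open>\<tau>\<close>
    leaves \<open>s^2*k*B \<le> F\<close>.\<close>
  define B where "B = \<tau>*(2*\<rho>-1) + (2*s-1)*(\<tau>+F)"
  have B0: "0 \<le> B" unfolding B_def using pos fg s1 by (intro add_nonneg_nonneg mult_nonneg_nonneg) auto
  have "3*c*F - B = 4*(g-s)*F" unfolding B_def F \<tau> c_def d_def by algebra
  then have "B \<le> 3*c*F" using s fg by (smt (verit) mult_nonneg_nonneg)
  then have "g^2*k*B \<le> g^2*k*(3*c*F)" using cs by (intro mult_left_mono) auto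
  also have "\<dots> = F" using cs(7) by (metis mult.assoc mult.commute mult_1)
  finally have "g^2*k*B \<le> F" .
  moreover have "s^2*k*B \<le> g^2*k*B" using s pos cs B0 by (intro mult_right_mono power_mono) auto
  ultimately have "\<tau>*(s^2*k*B) \<le> \<tau>*F" using pos by (intro mult_left_mono) auto
  moreover have "Y*(\<tau>+F) \<le> s^2*\<tau>*(k*(2*s-1))*(\<tau>+F)"
    using Yle pos fg by (intro mult_right_mono) auto
  ultimately show ?thesis unfolding B_def G by (simp add: algebra_simps power2_eq_square)
qed

text \<open>Right side minus left side is a concave quadratic in \<open>t\<close>. By
  \<open>slope\<close> its derivative at \<open>t = c\<close> is nonnegative, so it increases up to
  \<open>c\<close> and the worst case is \<open>t = s - d\<close>.\<close>

lemma loss_balance_small: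
  assumes s: "c \<le> s" "s \<le> g" and \<rho>: "c \<le> \<rho>" "\<rho> \<le> g" and t: "s - d \<le> t" "t \<le> c"
    and F: "F = s + \<rho> - 1" and G: "G = k*(2*\<rho>-1)" and Y: "Y = s*(s-c)/c"
  shows "Y*(t+F) \<le> t*F - s^2*t^2*G"
proof -
  note cs = constants
  have fg: "0 < F" "0 < G" using linear_factor_bounds[of s \<rho> F G] assms g by auto
  have base: "Y*((s-d)+F) \<le> (s-d)*F - s^2*(s-d)^2*G"
    using loss_balance_small_base[OF s \<rho> F G Y refl] .
  have slope: "2*s^2*c*G + Y \<le> F"
  proof -
    have "2*s^2*c*G = 2*s^2*(2*\<rho>-1)/(3*g^2)" using cs by (simp add: G k_def)
    also have "\<dots> \<le> 2*(g*s)*(2*\<rho>-1)/(3*g^2)" using s \<rho> cs g unfolding power2_eq_square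
      by (intro divide_right_mono mult_right_mono mult_left_mono) (auto simp: c_def)
    also have "\<dots> = 2*s*(2*\<rho>-1)/(3*g)" using cs by (simp add: power2_eq_square)
    finally have 1: "2*s^2*c*G \<le> 2*s*(2*\<rho>-1)/(3*g)" .
    have 2: "Y \<le> g*(s-c)/c" unfolding Y using s cs by (intro divide_right_mono mult_right_mono) auto
    \<comment> \<open>The bounds \<open>1\<close> and \<open>2\<close> are linear in
      \<open>s\<close>. At \<open>s = g\<close> the claim holds with surplus
      \<open>(g-\<rho>)/3\<close>, and the second identity shows that decreasing \<open>s\<close>
      preserves it.\<close>
    have "2*g*(2*\<rho>-1)/(3*g) + g*(g-c)/c + (g-\<rho>)/3 = g+\<rho>-1"
    proof -
      have "2*g*(2*\<rho>-1)/(3*g) = 2*(2*\<rho>-1)/3" using cs by simp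
      moreover have "g*(g-c)/c = c/3" using cs(1,6) by (simp add: c_def d_def divide_simps power2_eq_square)
      ultimately show ?thesis by (simp add: c_def field_simps)
    qed
    moreover have "2*s*(2*\<rho>-1)/(3*g) + g*(s-c)/c - s
        = 2*g*(2*\<rho>-1)/(3*g) + g*(g-c)/c - g - (g-s)*(2*(2*\<rho>-1)/(3*g) + (g/c-1))"
      using cs by (simp add: field_simps)
    moreover have "0 \<le> (g-s)*(2*(2*\<rho>-1)/(3*g) + (g/c-1))"
      using s \<rho> cs g by (intro mult_nonneg_nonneg add_nonneg_nonneg divide_nonneg_nonneg) (auto simp: c_def divide_simps)
    ultimately have "2*s*(2*\<rho>-1)/(3*g) + g*(s-c)/c \<le> s + \<rho> - 1" using \<rho> by argo
    then show ?thesis using 1 2 unfolding F by argo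
  qed
  have "s^2*(t+(s-d))*G \<le> s^2*(2*c)*G"
    using t fg by (intro mult_right_mono mult_left_mono) auto
  then have "s^2*(t+(s-d))*G + Y \<le> F" using slope by (simp add: mult_ac)
  then have "(t-(s-d))*(s^2*(t+(s-d))*G + Y) \<le> (t-(s-d))*F" using t by (intro mult_left_mono) auto
  moreover have "(t-(s-d))*(s^2*(t+(s-d))*G + Y) = s^2*t^2*G - s^2*(s-d)^2*G + Y*t - Y*(s-d)"
    by (simp add: algebra_simps power2_eq_square)
  ultimately show ?thesis using base by (simp add: algebra_simps)
qed

text \<open>Here \<open>t \<ge> c\<close>. Multiplied by \<open>t\<close>, the claim is affine in
  \<open>\<epsilon> = g - \<rho>\<close>: \<open>main\<close> handles the constant term and
  \<open>slope\<close> the coefficient of \<open>\<epsilon>\<close>.\<close>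

lemma loss_balance_large_base:
  assumes s: "g \<le> s" "s \<le> 1" and \<rho>: "c \<le> \<rho>" "\<rho> \<le> g"
    and F: "F = s + \<rho> - 1" and G: "G = k*(2*\<rho>-1)" and t: "t = s - d"
  shows "s*(s-t)/t*(t+F) \<le> t*F - s^2*t^2*G"
proof -
  note cs = constants
  define \<epsilon> where "\<epsilon> = g - \<rho>"
  define e where "e = s - g"
  have e: "0 \<le> \<epsilon>" "0 \<le> e" "e \<le> d" using s \<rho> by (auto simp: \<epsilon>_def e_def d_def)
  have tc: "c \<le> t" "0 < t" and te: "t = c + e" and se: "s = g + e"
    using s cs by (auto simp: t c_def d_def e_def)
  have s0: "0 < s" using cs s by auto
  have Fe: "F = t - \<epsilon>" and Ge: "G = k*(c-2*\<epsilon>)"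
    by (auto simp: F G t \<epsilon>_def d_def c_def)
  have slope: "t^2 \<le> 2*s^2*t^3*k + s*d"
  proof -
    have "2*g^2*t^3*k \<le> 2*s^2*t^3*k" using s cs tc
      by (intro mult_right_mono mult_left_mono power_mono) auto
    moreover have "3*c*(2*g^2*t^3*k) = 2*t^3*(3*c*g^2*k)" by (simp add: mult_ac)
    then have "3*c*(2*g^2*t^3*k) = 2*t^3" using cs(7) by simp
    \<comment> \<open>Expansion around \<open>t = c\<close>; the constant term vanishes because
      \<open>c + d = g\<close> and \<open>c^2 = 3*g*d\<close>.\<close>
    moreover have "2*t^3 + 3*c*(s*d) - 3*c*t^2 = (t-c)*(t*(t-c) + t^2 + 3*c*d - c^2) + 3*c*d*(c+d) - c^3"
      unfolding t by (simp add: algebra_simps power2_eq_square power3_eq_cube)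
    moreover have "3*c*d*(c+d) - c^3 = 0" using cs(6) unfolding c_def d_def by algebra
    moreover have "0 \<le> (t-c)*(t*(t-c) + t^2 + 3*c*d - c^2)"
    proof -
      have "c^2 \<le> t^2" using tc cs by (intro power_mono) auto
      then show ?thesis using tc cs by (intro mult_nonneg_nonneg) (smt (verit) mult_nonneg_nonneg)+
    qed
    ultimately have "3*c*t^2 \<le> 3*c*(2*s^2*t^3*k + s*d)"
      using cs(1) by (smt (verit) mult_left_mono distrib_left)
    then show ?thesis using cs(1) by simp
  qed
  \<comment> \<open>The inequality \<open>main\<close> is an equality at \<open>e = 0\<close>; this
    compares the cofactors of \<open>e\<close>.\<close>
  have "(2*g+e)*(c+e)^2 \<le> (4*c-6*d+2*e)*g^2"
  proof -
    have "c+e \<le> g" using e by (simp add: c_def d_def)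
    then have "(2*g+e)*(c+e)^2 \<le> (2*g+e)*(g*(c+e))"
      unfolding power2_eq_square using e cs by (intro mult_left_mono mult_right_mono) auto
    also have "\<dots> = g*(2*g*c + e*(2*g+c+e))" by (simp add: algebra_simps)
    also have "\<dots> \<le> g*(2*g*c + e*(3*g))"
      using e cs by (intro mult_left_mono add_left_mono) (auto simp: c_def d_def)
    also have "\<dots> = g^2*(2*c+3*e)" by (simp add: algebra_simps power2_eq_square)
    \<comment> \<open>As \<open>e \<le> d\<close>, it suffices that \<open>7*d \<le> 2*c\<close>,
      which is exactly \<open>9/11 \<le> g\<close>.\<close>
    also have "\<dots> \<le> g^2*(4*c-6*d+2*e)"
      using e g by (intro mult_left_mono) (auto simp: c_def d_def)
    finally show ?thesis by (simp add: mult.commute)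
  qed
  then have "0 \<le> e*((4*c-6*d+2*e)*g^2 - (2*g+e)*(c+e)^2)" using e by simp
  also have "\<dots> = 3*g^2*t^2 - 6*g^2*s*d - s^2*t^2"
    using cs(6) unfolding te se by algebra
  finally have "s^2*t^2 + 6*g^2*(s*d) \<le> 3*g^2*t^2" by simp
  then have "(s^2*t^2 + 6*g^2*(s*d))*(c*k) \<le> 3*g^2*t^2*(c*k)"
    using cs by (intro mult_right_mono) auto
  moreover have "3*g^2*t^2*(c*k) = t^2*(3*c*g^2*k)" "6*g^2*(s*d)*(c*k) = 2*(s*d)*(3*c*g^2*k)"
    by (simp_all add: mult_ac)
  ultimately have main: "s^2*t^2*(c*k) + 2*(s*d) \<le> t^2" using cs(7) by (simp add: distrib_right)
  have "0 \<le> t*(t^2 - s^2*t^2*(c*k) - 2*(s*d)) + \<epsilon>*(2*s^2*t^3*k + s*d - t^2)"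
    using main slope e tc by (intro add_nonneg_nonneg mult_nonneg_nonneg) auto
  also have "\<dots> = t*(t*F - s^2*t^2*G) - s*d*(t+F)" unfolding Fe Ge
    by (simp add: algebra_simps power2_eq_square power3_eq_cube)
  finally have "s*d*(t+F) \<le> t*(t*F - s^2*t^2*G)" by simp
  then have "s*d*(t+F)/t \<le> t*F - s^2*t^2*G" using tc by (simp add: pos_divide_le_eq mult.commute)
  moreover have "s - t = d" by (simp add: t)
  ultimately show ?thesis by simp
qed

text \<open>After division by \<open>t\<close>, all dependence on \<open>t\<close> is on the left
  and decreasing: \<open>t*G + 1/t\<close> because \<open>t \<le> 1\<close> and
  \<open>G \<le> 1\<close>, and \<open>(s-t)/t^2\<close> because \<open>t \<le> s\<close>.\<close>

lemma loss_balance_mono: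
  fixes s t t\<^sub>1 F G :: real
  assumes s: "0 < s" and t: "0 < t\<^sub>1" "t\<^sub>1 \<le> t" "t \<le> s" "t \<le> 1" and fg: "0 < F" "0 < G" "G \<le> 1"
    and base: "s*(s-t\<^sub>1)/t\<^sub>1*(t\<^sub>1+F) \<le> t\<^sub>1*F - s^2*t\<^sub>1^2*G"
  shows "s*(s-t)/t*(t+F) \<le> t*F - s^2*t^2*G"
proof -
  have eq: "(s*(s-v)/v*(v+F) \<le> v*F - s^2*v^2*G) \<longleftrightarrow> s^2*(v*G + 1/v) - s + s*(s-v)/v^2*F \<le> F"
    if "0 < v" for v
  proof -
    have "v*(s^2*(v*G + 1/v) - s + s*(s-v)/v^2*F) = s*(s-v)/v*(v+F) + s^2*v^2*G"
      using that by (simp add: divide_simps power2_eq_square) (simp add: algebra_simps)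
    then have "(s^2*(v*G + 1/v) - s + s*(s-v)/v^2*F \<le> F) \<longleftrightarrow> s*(s-v)/v*(v+F) + s^2*v^2*G \<le> v*F"
      using that by (metis mult_le_cancel_left_pos)
    then show ?thesis by auto
  qed
  have t0: "0 < t" using t by simp
  have "t*G + 1/t \<le> t\<^sub>1*G + 1/t\<^sub>1"
  proof -
    have "t*t\<^sub>1*G \<le> 1*1*1" using t fg by (intro mult_mono) auto
    then have "(t-t\<^sub>1)*(t*t\<^sub>1*G) \<le> (t-t\<^sub>1)*1" using t by (intro mult_left_mono) auto
    then show ?thesis using t t0 by (simp add: field_simps power2_eq_square)
  qed
  then have "s^2*(t*G + 1/t) \<le> s^2*(t\<^sub>1*G + 1/t\<^sub>1)" by (intro mult_left_mono) auto
  moreover have "s*(s-t)/t^2*F \<le> s*(s-t\<^sub>1)/t\<^sub>1^2*F"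
    using t s fg by (intro mult_right_mono frac_le mult_left_mono power_mono) auto
  ultimately show ?thesis using base eq[OF t(1)] eq[OF t0] by linarith
qed

text \<open>
  Here \<open>s\<close>, \<open>t\<close> and \<open>F\<close> are the densities (or lower bounds for them) of \<open>xy\<close>, \<open>xya\<close> and
  \<open>xyab\<close>, and \<open>G\<close> bounds the loss at \<open>ab\<close>. In all cases the worst \<open>t\<close> is \<open>s - d\<close>.
\<close>

lemma loss_balance:
  assumes s: "c \<le> s" "s \<le> 1" and \<rho>: "c \<le> \<rho>" "\<rho> \<le> g" and t: "s - d \<le> t" "t \<le> s"
    and F: "F = s + \<rho> - 1" and G: "G = k*(2*\<rho>-1)" 
  shows "s^2*(1/max t c - 1/s)*(t+F) \<le> t*F - s^2*t^2*G"
proof -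
  note cs = constants
  note fg = linear_factor_bounds[OF s \<rho> F G]
  have pos: "0 < s" "0 < t" "t \<le> 1" using cs s t by auto
  have eq: "s^2*(1/v - 1/s) = s*(s-v)/v" if "0 < v" for v
    using that pos by (simp add: field_simps power2_eq_square)
  show ?thesis
  proof (cases "t \<le> c")
    case True
    then show ?thesis using loss_balance_small[OF s(1) _ \<rho> t(1) True F G refl] eq[OF cs(1)] t
      by (simp add: max_def c_def d_def)
  next
    case False
    have "s*(s-t)/t*(t+F) \<le> t*F - s^2*t^2*G"
    proof (cases "s \<le> g")
      case True
      \<comment> \<open>The point \<open>t = c\<close> belongs to both regimes and starts the
        monotone range.\<close>
      have "s*(s-c)/c*(c+F) \<le> c*F - s^2*c^2*G"
        using loss_balance_small[OF s(1) True \<rho> _ order_refl F G refl] True by (simp add: c_def d_def)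
      then show ?thesis using loss_balance_mono[of s c t F G] pos cs fg t False by simp
    next
      case sg: False
      have "s*(s-(s-d))/(s-d)*((s-d)+F) \<le> (s-d)*F - s^2*(s-d)^2*G"
        using loss_balance_large_base[OF _ s(2) \<rho> F G refl] sg by simp
      then show ?thesis using loss_balance_mono[of s "s-d" t F G] pos cs fg t s by simp
    qed
    then show ?thesis using False eq[OF pos(2)] by (simp add: max_def)
  qed
qed

text \<open>The letters \<open>s\<close>, \<open>r\<close>, \<open>t\<close>, \<open>f\<close>,
  \<open>p\<close>, \<open>q\<close> are the densities of xy, ab, xya, xyab, xyz, xyza, and
  \<open>u\<^sub>x\<close>, \<open>u\<^sub>y\<close> those of abx, aby. The three losses are at most
  \<open>Q/t\<close>, \<open>G\<close> and \<open>G\<close>, which reduces the claim to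
  \<open>loss_balance\<close>; then \<open>p \<le> s\<close> and \<open>q \<le> t\<close> account
  for the vertex z.\<close>

lemma five_clique_inequality:
  assumes xy: "c \<le> s" "s \<le> 1" and ab: "c \<le> r" "r \<le> 1"
    and cross: "c \<le> s\<^sub>x\<^sub>a" "c \<le> s\<^sub>y\<^sub>a" "c \<le> s\<^sub>x\<^sub>b" "c \<le> s\<^sub>y\<^sub>b"
    and t: "s - d \<le> t" "t \<le> s" "t \<le> s\<^sub>x\<^sub>a" "t \<le> s\<^sub>y\<^sub>a"
    and ux: "r - d \<le> u\<^sub>x" "u\<^sub>x \<le> s\<^sub>x\<^sub>a" "u\<^sub>x \<le> s\<^sub>x\<^sub>b"
    and uy: "r - d \<le> u\<^sub>y" "u\<^sub>y \<le> s\<^sub>y\<^sub>a" "u\<^sub>y \<le> s\<^sub>y\<^sub>b"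
    and f: "s + r - 1 \<le> f"
    and T: "0 < p" "p \<le> s" "0 < q" "q \<le> t"
  shows "0 \<le> 1/(3*s*p*q) + (1/s - (1/s\<^sub>x\<^sub>a + 1/s\<^sub>y\<^sub>a)/2)/(3*t*q)
    + ((1/s - (1/s\<^sub>x\<^sub>a + 1/s\<^sub>y\<^sub>a)/2)/(3*t)
       + ((1/r - (1/s\<^sub>x\<^sub>a + 1/s\<^sub>x\<^sub>b)/2)/(3*u\<^sub>x) + (1/r - (1/s\<^sub>y\<^sub>a + 1/s\<^sub>y\<^sub>b)/2)/(3*u\<^sub>y))/2) / f"
proof -
  note cs = constants
  \<comment> \<open>Capping at \<open>g\<close> matches \<open>gadget_loss_bound\<close> and only
    lowers \<open>F\<close>.\<close>
  define \<rho> where "\<rho> = min r g"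
  define F where "F = s + \<rho> - 1"
  define G where "G = k*(2*\<rho>-1)"
  define Q where "Q = 1/max t c - 1/s"
  have \<rho>: "c \<le> \<rho>" "\<rho> \<le> g" using ab cs by (auto simp: \<rho>_def)
  note fg = linear_factor_bounds[OF xy \<rho> F_def G_def]
  have pos: "0 < s" "0 < t" "0 < r" "0 < u\<^sub>x" "0 < u\<^sub>y" "0 < s\<^sub>x\<^sub>a" "0 < s\<^sub>y\<^sub>a" "0 < s\<^sub>x\<^sub>b" "0 < s\<^sub>y\<^sub>b"
    using cs xy ab t ux uy cross by auto
  have Ff: "F \<le> f" using f by (auto simp: F_def \<rho>_def)
  have f0: "0 < f" using Ff fg by simp
  have inv: "1/v \<le> 1/max w c" if "w \<le> v" "c \<le> v" for v w :: real
    using that cs by (intro divide_left_mono mult_pos_pos) auto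
  have Q: "(1/s\<^sub>x\<^sub>a + 1/s\<^sub>y\<^sub>a)/2 - 1/s \<le> Q"
    using inv[of t s\<^sub>x\<^sub>a] inv[of t s\<^sub>y\<^sub>a] cross t by (simp add: Q_def)
  have Q0: "0 \<le> Q" using inv[of "max t c" s] t xy by (simp add: Q_def)
  have lx: "((1/s\<^sub>x\<^sub>a + 1/s\<^sub>x\<^sub>b)/2 - 1/r)/u\<^sub>x \<le> G"
  proof -
    have "((1/s\<^sub>x\<^sub>a + 1/s\<^sub>x\<^sub>b)/2 - 1/r)/u\<^sub>x \<le> (1/max u\<^sub>x c - 1/r)/u\<^sub>x"
      using inv[of u\<^sub>x s\<^sub>x\<^sub>a] inv[of u\<^sub>x s\<^sub>x\<^sub>b] cross ux pos by (intro divide_right_mono) auto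
    also have "\<dots> \<le> G" using gadget_loss_bound[OF ab(1) ux(1)] by (simp add: G_def \<rho>_def)
    finally show ?thesis .
  qed
  have ly: "((1/s\<^sub>y\<^sub>a + 1/s\<^sub>y\<^sub>b)/2 - 1/r)/u\<^sub>y \<le> G"
  proof -
    have "((1/s\<^sub>y\<^sub>a + 1/s\<^sub>y\<^sub>b)/2 - 1/r)/u\<^sub>y \<le> (1/max u\<^sub>y c - 1/r)/u\<^sub>y"
      using inv[of u\<^sub>y s\<^sub>y\<^sub>a] inv[of u\<^sub>y s\<^sub>y\<^sub>b] cross uy pos by (intro divide_right_mono) auto
    also have "\<dots> \<le> G" using gadget_loss_bound[OF ab(1) uy(1)] by (simp add: G_def \<rho>_def)
    finally show ?thesis .
  qed
  have "s^2*Q*(t+F) \<le> t*F - s^2*t^2*G"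
    using loss_balance[OF xy \<rho> t(1,2) F_def G_def] by (simp add: Q_def)
  then have "s^2*(Q*t + t^2*G) \<le> F*(t - s^2*Q)" by (simp add: algebra_simps)
  \<comment> \<open>Replacing \<open>F\<close> by the larger \<open>f\<close> requires
    \<open>t - s^2*Q\<close> to be positive, which follows from the positive left side.\<close>
  moreover have "0 < s^2*(Q*t + t^2*G)" using pos Q0 fg by (intro mult_pos_pos add_nonneg_pos) auto
  ultimately have "0 < F*(t - s^2*Q)" by simp
  then have "0 < t - s^2*Q" using fg by (simp add: zero_less_mult_iff)
  then have "F*(t - s^2*Q) \<le> f*(t - s^2*Q)" using Ff by (intro mult_right_mono) auto
  then have "s^2*(Q*t + t^2*G) \<le> f*(t - s^2*Q)" using \<open>s^2*(Q*t + t^2*G) \<le> F*(t - s^2*Q)\<close> by simp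
  then have main: "Q/t + t*(Q/t + G)/f \<le> 1/(s*s)"
    using pos f0 by (simp add: field_simps power2_eq_square)
  have "Q/t + q*(Q/t + G)/f \<le> Q/t + t*(Q/t + G)/f"
    using T Q0 fg pos f0 by (intro add_left_mono divide_right_mono mult_right_mono) auto
  also note main
  also have "1/(s*s) \<le> 1/(s*p)" using pos T by (intro divide_left_mono mult_left_mono) auto
  finally have "(Q/t + q*(Q/t + G)/f)/q \<le> 1/(s*p)/q" using T by (intro divide_right_mono) auto
  then have bal: "Q/t/q + (Q/t + G)/f \<le> 1/(s*p*q)" using T by (simp add: add_divide_distrib)
  define A where "A = ((1/s\<^sub>x\<^sub>a + 1/s\<^sub>y\<^sub>a)/2 - 1/s)/t"
  define Bx where "Bx = ((1/s\<^sub>x\<^sub>a + 1/s\<^sub>x\<^sub>b)/2 - 1/r)/u\<^sub>x"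
  define By where "By = ((1/s\<^sub>y\<^sub>a + 1/s\<^sub>y\<^sub>b)/2 - 1/r)/u\<^sub>y"
  have A: "A \<le> Q/t" unfolding A_def using Q pos by (intro divide_right_mono) auto
  have "A/q + (A + (Bx+By)/2)/f \<le> Q/t/q + (Q/t + G)/f"
    using A lx ly T f0 unfolding Bx_def[symmetric] By_def[symmetric]
    by (intro add_mono divide_right_mono) auto
  with bal have "0 \<le> (1/(s*p*q) - A/q - (A + (Bx+By)/2)/f)/3" by simp
  also have "\<dots> = 1/(3*s*p*q) + (-A/3)/q + (-A/3 + (-Bx/3 + -By/3)/2)/f"
    by (simp add: diff_divide_distrib add_divide_distrib)
  also have "-A/3 = (1/s - (1/s\<^sub>x\<^sub>a + 1/s\<^sub>y\<^sub>a)/2)/(3*t)"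
    by (simp add: A_def minus_divide_left)
  also have "-Bx/3 = (1/r - (1/s\<^sub>x\<^sub>a + 1/s\<^sub>x\<^sub>b)/2)/(3*u\<^sub>x)"
    by (simp add: Bx_def minus_divide_left)
  also have "-By/3 = (1/r - (1/s\<^sub>y\<^sub>a + 1/s\<^sub>y\<^sub>b)/2)/(3*u\<^sub>y)"
    by (simp add: By_def minus_divide_left)
  finally show ?thesis by simp
qed

end

section \<open>Summation over the orderings of a 5-clique\<close>

lemma sum_permutations_of_set:
  assumes "finite A" "A \<noteq> {}"
  shows "sum h (permutations_of_set A)
    = (\<Sum>x\<in>A. \<Sum>xs\<in>permutations_of_set (A - {x}). h (x # xs))"
proof -
  have "sum h (permutations_of_set A)
      = sum h (\<Union>x\<in>A. (\<lambda>xs. x # xs) ` permutations_of_set (A - {x}))"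
    using permutations_of_set_nonempty[OF assms(2)] by simp
  also have "\<dots> = (\<Sum>x\<in>A. sum h ((\<lambda>xs. x # xs) ` permutations_of_set (A - {x})))"
    using assms(1) by (intro sum.UNION_disjoint) auto
  also have "\<dots> = (\<Sum>x\<in>A. \<Sum>xs\<in>permutations_of_set (A - {x}). h (x # xs))"
    by (intro sum.cong refl sum.reindex[unfolded o_def]) (auto simp: inj_on_def)
  finally show ?thesis .
qed

text \<open>\<open>R\<close> stands for the reciprocal density. With \<open>x\<close>,
  \<open>y\<close> on one side of the triangle and \<open>a\<close> on the other, this collects the
  choices of $v_1v_2$ inside \<open>{x, y, a}\<close>: the pair \<open>xy\<close> has gadget value
  1/3, the two mixed pairs -1/6.\<close>

definition apex_term :: "('a set \<Rightarrow> real) \<Rightarrow> 'a \<Rightarrow> 'a \<Rightarrow> 'a \<Rightarrow> real" where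
  "apex_term R x y a = R {x, y, a} * (R {x, y} - (R {x, a} + R {y, a}) / 2) / 3"

text \<open>
  Taking \<open>xy\<close> for $v_1v_2$, the first summand comes from $v_3 = z$ and the second
  contains $v_4 = z$; the mixed terms of weight $-\frac16$ are shared out among the edges
  of the triangle, and the terms in \<open>ab\<close> are halved since both orders of \<open>a\<close>, \<open>b\<close> occur.
\<close>

definition edge_balance :: "('a set \<Rightarrow> real) \<Rightarrow> 'a \<Rightarrow> 'a \<Rightarrow> 'a \<Rightarrow> 'a \<Rightarrow> 'a \<Rightarrow> real" where
  "edge_balance R x y z a b =
    R {x, y} * R {x, y, z} * R {x, y, z, a} / 3
    + R {x, y, z, a} * apex_term R x y a
    + R {x, y, a, b} * (apex_term R x y a + (apex_term R a b x + apex_term R a b y) / 2)"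

text \<open>All 120 orderings are enumerated. The factor 2 comes from exchanging the first two
  entries.\<close>

lemma sum_permutations_clique5:
  fixes R :: "'a set \<Rightarrow> real"
  assumes "distinct [x, y, z, a, b]"
  shows "(\<Sum>vs\<in>permutations_of_set {x, y, z, a, b}.
      R {vs!0, vs!1} * R {vs!0, vs!1, vs!2} * R {vs!0, vs!1, vs!2, vs!3}
      * (if (vs!0 \<in> {x, y, z}) = (vs!1 \<in> {x, y, z}) then 1/3 else -1/6)) =
    2 * (edge_balance R x y z a b + edge_balance R x y z b a
      + edge_balance R y z x a b + edge_balance R y z x b a
      + edge_balance R x z y a b + edge_balance R x z y b a)"
proof -
  have ne: "x \<noteq> y" "x \<noteq> z" "x \<noteq> a" "x \<noteq> b" "y \<noteq> z" "y \<noteq> a" "y \<noteq> b" "z \<noteq> a" "z \<noteq> b" "a \<noteq> b"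
    "y \<noteq> x" "z \<noteq> x" "a \<noteq> x" "b \<noteq> x" "z \<noteq> y" "a \<noteq> y" "b \<noteq> y" "a \<noteq> z" "b \<noteq> z" "b \<noteq> a"
    using assms by auto
  show ?thesis
    by (simp add: sum_permutations_of_set ne insert_Diff_if insert_commute
        edge_balance_def apex_term_def algebra_simps add_divide_distrib diff_divide_distrib)
qed

section \<open>Common neighbourhoods and their densities\<close>

definition common_nbrs :: "'a set \<Rightarrow> 'a set set \<Rightarrow> 'a set \<Rightarrow> 'a set" where
  "common_nbrs V E S = {v \<in> V. \<forall>u\<in>S. {u, v} \<in> E}"

lemma simple_graph_no_loop: "simple_graph V E \<Longrightarrow> {v, v} \<notin> E"
  by (auto simp: simple_graph_def)

text \<open>A one-vertex extension is determined by the new vertex, a common neighbour of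
  \<open>S\<close>; without loops no common neighbour lies in \<open>S\<close>.\<close>

lemma card_cliques_containing:
  assumes G: "simple_graph V E" and S: "S \<in> cliques V E i"
  shows "card (cliques_containing V E (i + 1) S) = card (common_nbrs V E S)"
proof -
  have fin: "finite S" and SV: "S \<subseteq> V" and cS: "card S = i"
    using G S finite_subset by (auto simp: simple_graph_def cliques_def)
  have notin: "v \<notin> S" if "v \<in> common_nbrs V E S" for v
    using that simple_graph_no_loop[OF G, of v] by (auto simp: common_nbrs_def)
  have "cliques_containing V E (i + 1) S = (\<lambda>v. insert v S) ` common_nbrs V E S"
  proof (intro equalityI subsetI)
    fix K assume K: "K \<in> cliques_containing V E (i + 1) S"
    then have "finite K" "S \<subseteq> K" "card K = i + 1"
      using G finite_subset by (auto simp: simple_graph_def cliques_containing_def cliques_def)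
    then have "card (K - S) = 1" using cS fin by (simp add: card_Diff_subset)
    then obtain v where v: "K - S = {v}" by (auto simp: card_1_singleton_iff)
    then have "K = insert v S" "v \<notin> S" using \<open>S \<subseteq> K\<close> by auto
    moreover have "v \<in> common_nbrs V E S"
    proof -
      have "{u, v} \<in> E" if "u \<in> S" for u
      proof -
        have "u \<in> K" "v \<in> K" "u \<noteq> v" using that v \<open>S \<subseteq> K\<close> by auto
        then show ?thesis using K by (simp add: cliques_containing_def cliques_def)
      qed
      moreover have "v \<in> V" using K v by (auto simp: cliques_containing_def cliques_def)
      ultimately show ?thesis by (simp add: common_nbrs_def)
    qed
    ultimately show "K \<in> (\<lambda>v. insert v S) ` common_nbrs V E S" by auto
  next
    fix K assume "K \<in> (\<lambda>v. insert v S) ` common_nbrs V E S"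
    then obtain v where v: "v \<in> common_nbrs V E S" "K = insert v S" by auto
    then show "K \<in> cliques_containing V E (i + 1) S"
      using notin[OF v(1)] S fin
      by (auto simp: cliques_containing_def cliques_def common_nbrs_def insert_commute)
  qed
  moreover have "inj_on (\<lambda>v. insert v S) (common_nbrs V E S)"
    using notin by (auto simp: inj_on_def)
  ultimately show ?thesis by (simp add: card_image)
qed

lemma degree_eq_card_common_nbrs:
  assumes G: "simple_graph V E"
  shows "degree E v = card (common_nbrs V E {v})"
proof -
  have "{e \<in> E. v \<in> e} = (\<lambda>u. {v, u}) ` common_nbrs V E {v}"
  proof (intro equalityI subsetI)
    fix e assume e: "e \<in> {e \<in> E. v \<in> e}"
    then have "card e = 2" "e \<subseteq> V" using G by (auto simp: simple_graph_def)
    then obtain p q where "e = {p, q}" by (auto simp: card_2_iff)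
    then show "e \<in> (\<lambda>u. {v, u}) ` common_nbrs V E {v}"
      using e \<open>e \<subseteq> V\<close> by (auto simp: common_nbrs_def insert_commute image_iff)
  qed (auto simp: common_nbrs_def)
  moreover have "inj_on (\<lambda>u. {v, u}) (common_nbrs V E {v})"
    by (auto simp: inj_on_def doubleton_eq_iff)
  ultimately show ?thesis by (simp add: degree_def card_image)
qed

text \<open>The function D of the opening sketch; dividing by \<open>card V\<close> frees the
  inequalities from the order of the graph.\<close>

definition nbr_density :: "'a set \<Rightarrow> 'a set set \<Rightarrow> 'a set \<Rightarrow> real" where
  "nbr_density V E S = real (card (common_nbrs V E S)) / real (card V)"

lemma nbr_density_antimono:
  assumes "finite V" "S \<subseteq> T"
  shows "nbr_density V E T \<le> nbr_density V E S"
  unfolding nbr_density_def using assms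
  by (intro divide_right_mono of_nat_mono card_mono) (auto simp: common_nbrs_def)

lemma nbr_density_le_1: "finite V \<Longrightarrow> nbr_density V E S \<le> 1"
  unfolding nbr_density_def
  by (cases "card V = 0") (auto simp: divide_simps common_nbrs_def intro!: card_mono)

text \<open>Inclusion-exclusion inside \<open>V\<close>, as the common neighbourhood of a union is
  an intersection.\<close>

lemma nbr_density_Un:
  assumes "finite V" "V \<noteq> {}"
  shows "nbr_density V E S + nbr_density V E T - 1 \<le> nbr_density V E (S \<union> T)"
proof -
  let ?A = "common_nbrs V E S" and ?B = "common_nbrs V E T"
  have sub: "?A \<subseteq> V" "?B \<subseteq> V" by (auto simp: common_nbrs_def)
  then have fin: "finite ?A" "finite ?B" using assms finite_subset by auto
  have "common_nbrs V E (S \<union> T) = ?A \<inter> ?B" by (auto simp: common_nbrs_def)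
  moreover have "card ?A + card ?B = card (?A \<union> ?B) + card (?A \<inter> ?B)"
    using fin by (rule card_Un_Int)
  moreover have "card (?A \<union> ?B) \<le> card V" using sub assms by (intro card_mono) auto
  ultimately have "card ?A + card ?B \<le> card V + card (common_nbrs V E (S \<union> T))" by simp
  then have "real (card ?A) + real (card ?B) \<le> real (card V) + real (card (common_nbrs V E (S \<union> T)))"
    by linarith
  moreover have "0 < card V" using assms by (simp add: card_gt_0_iff)
  ultimately show ?thesis unfolding nbr_density_def by (simp add: divide_simps)
qed

text \<open>Monotonicity, inclusion-exclusion and the degree bound supply the constraints of
  \<open>five_clique_inequality\<close>.\<close>

lemma edge_balance_nonneg:
  fixes V :: "'a set" and E :: "'a set set" and g :: real
  assumes g: "7*g^2 - 7*g + 1 = 0" "9/11 \<le> g" "g < 1"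
    and fin: "finite V" and vert: "{x, y, z, a, b} \<subseteq> V"
    and deg: "\<And>v. v \<in> V \<Longrightarrow> g \<le> nbr_density V E {v}"
  shows "0 \<le> edge_balance (\<lambda>S. 1 / nbr_density V E S) x y z a b"
proof -
  define D where "D = nbr_density V E"
  have ne: "V \<noteq> {}" using vert by auto
  have mono: "D T \<le> D S" if "S \<subseteq> T" for S T
    using nbr_density_antimono[OF fin that] by (simp add: D_def)
  have union: "D S + D T - 1 \<le> D (S \<union> T)" for S T
    using nbr_density_Un[OF fin ne] by (simp add: D_def)
  have add: "D S - (1 - g) \<le> D (insert v S)" if "v \<in> V" for v S
    using union[of S "{v}"] deg[OF that] by (simp add: D_def)
  have pair: "2*g - 1 \<le> D {v, w}" if "v \<in> V" "w \<in> V" for v w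
    using add[OF that(1), of "{w}"] deg[OF that(2)] by (simp add: D_def)
  \<comment> \<open>\<open>3*g - 2\<close> and \<open>4*g - 3\<close> are positive for
    \<open>9/11 \<le> g\<close>, so the densities involving \<open>z\<close> are nonzero.\<close>
  have triple: "3*g - 2 \<le> D {u, v, w}" if "u \<in> V" "v \<in> V" "w \<in> V" for u v w
    using add[OF that(1), of "{v, w}"] pair[OF that(2,3)] by simp
  have quad: "4*g - 3 \<le> D {t, u, v, w}" if "t \<in> V" "u \<in> V" "v \<in> V" "w \<in> V" for t u v w
    using add[OF that(1), of "{u, v, w}"] triple[OF that(2-4)] by linarith
  have "0 \<le> 1/(3*D{x,y}*D{x,y,z}*D{x,y,z,a})
      + (1/D{x,y} - (1/D{x,a} + 1/D{y,a})/2)/(3*D{x,y,a}*D{x,y,z,a})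
      + ((1/D{x,y} - (1/D{x,a} + 1/D{y,a})/2)/(3*D{x,y,a})
       + ((1/D{a,b} - (1/D{x,a} + 1/D{x,b})/2)/(3*D{a,b,x})
        + (1/D{a,b} - (1/D{y,a} + 1/D{y,b})/2)/(3*D{a,b,y}))/2) / D{x,y,a,b}"
  proof (rule five_clique_inequality[OF g refl refl refl])
    show "D {x, y} \<le> 1" "D {a, b} \<le> 1" using nbr_density_le_1[OF fin] by (auto simp: D_def)
    show "D {x, y} - (1 - g) \<le> D {x, y, a}" "D {a, b} - (1 - g) \<le> D {a, b, x}"
      "D {a, b} - (1 - g) \<le> D {a, b, y}"
      using add[of a "{x,y}"] add[of x "{a,b}"] add[of y "{a,b}"] vert
      by (simp_all add: insert_commute)
    show "D {x, y} + D {a, b} - 1 \<le> D {x, y, a, b}"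
      using union[of "{x,y}" "{a,b}"] by (simp add: insert_commute)
    show "0 < D {x, y, z}" "0 < D {x, y, z, a}"
      using triple[of x y z] quad[of x y z a] vert g by auto
  qed (use pair vert in \<open>auto intro!: mono\<close>)
  also have "\<dots> = edge_balance (\<lambda>S. 1 / D S) x y z a b"
    by (simp add: edge_balance_def apex_term_def insert_commute mult_ac)
  finally show ?thesis by (simp add: D_def)
qed

section \<open>Clique weights in terms of densities\<close>

lemma clique_subset: "S \<in> cliques V E k \<Longrightarrow> T \<subseteq> S \<Longrightarrow> T \<in> cliques V E (card T)"
  by (auto simp: cliques_def)

text \<open>The factors are reciprocal numbers of one-vertex extensions of the initial segments of
  lengths 2, 3 and 4, so each is a value of \<open>R\<close> divided by
  \<open>card V\<close>.\<close>

lemma clique_weight_conv: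
  assumes G: "simple_graph V E" and K: "set [v0, v1, v2, v3, v4] \<in> cliques V E 5"
    and vs: "distinct [v0, v1, v2, v3, v4]"
  defines "R \<equiv> \<lambda>S. 1 / nbr_density V E S"
  shows "clique_weight V E (take 4 [v0, v1, v2, v3, v4])
    = R {v0, v1} * R {v0, v1, v2} * R {v0, v1, v2, v3} / real (card V) ^ 3"
proof -
  have "card V \<noteq> 0" using G K by (auto simp: simple_graph_def cliques_def card_eq_0_iff)
  have c: "card (cliques_containing V E (length ws + 1) (set ws)) = card (common_nbrs V E (set ws))"
    if "set ws \<subseteq> set [v0, v1, v2, v3, v4]" "distinct ws" for ws
    using card_cliques_containing[OF G clique_subset[OF K that(1)]] that(2)
    by (simp add: distinct_card)
  have "card (cliques_containing V E 3 {v0, v1}) = card (common_nbrs V E {v0, v1})"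
    "card (cliques_containing V E 4 {v0, v1, v2}) = card (common_nbrs V E {v0, v1, v2})"
    "card (cliques_containing V E 5 {v0, v1, v2, v3}) = card (common_nbrs V E {v0, v1, v2, v3})"
    using c[of "[v0, v1]"] c[of "[v0, v1, v2]"] c[of "[v0, v1, v2, v3]"] vs
    by (auto simp: numeral_eq_Suc)
  moreover have "{2..4::nat} = {2, 3, 4}" by auto
  ultimately show ?thesis using \<open>card V \<noteq> 0\<close>
    by (simp add: clique_weight_def R_def nbr_density_def power3_eq_cube numeral_eq_Suc)
qed

lemma ordered_clique_gadget_conv:
  assumes "distinct vs" "2 \<le> length vs" "T \<subseteq> set vs"
  shows "ordered_clique_gadget vs T = (if (vs!0 \<in> T) = (vs!1 \<in> T) then 1/3 else -1/6)"
proof -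
  have "vs!0 \<noteq> vs!1" using nth_eq_iff_index_eq[OF assms(1), of 0 1] assms(2) by force
  then have "card ({vs!0, vs!1} \<inter> T) = (if vs!0 \<in> T then 1 else 0) + (if vs!1 \<in> T then 1 else 0)"
    by (simp add: Int_insert_left)
  then show ?thesis using assms by (auto simp: ordered_clique_gadget_def edge_gadget_def)
qed

text \<open>The fibre of \<open>set\<close> over a clique consists of its permutations.\<close>

lemma sum_ordered_cliques:
  assumes "finite V"
  shows "(\<Sum>vs\<in>ordered_cliques V E r. h vs)
    = (\<Sum>K\<in>cliques V E r. \<Sum>vs\<in>permutations_of_set K. h vs)"
proof -
  have finK: "finite (cliques V E r)"
    using assms by (rule finite_subset[rotated, OF finite_Pow_iff[THEN iffD2]]) (auto simp: cliques_def)
  have "ordered_cliques V E r \<subseteq> {vs. set vs \<subseteq> V \<and> length vs = r}"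
    by (auto simp: ordered_cliques_def cliques_def)
  then have "finite (ordered_cliques V E r)"
    using finite_lists_length_eq[OF assms] finite_subset by blast
  then have "(\<Sum>vs\<in>ordered_cliques V E r. h vs)
      = (\<Sum>K\<in>cliques V E r. sum h {vs \<in> ordered_cliques V E r. set vs = K})"
    using finK by (intro sum.group[symmetric]) (auto simp: ordered_cliques_def)
  also have "\<dots> = (\<Sum>K\<in>cliques V E r. \<Sum>vs\<in>permutations_of_set K. h vs)"
    by (intro sum.cong refl)
      (auto simp: ordered_cliques_def permutations_of_set_def cliques_def distinct_card)
  finally show ?thesis .
qed

text \<open>If \<open>T\<close> is not inside \<open>K\<close>, every gadget vanishes. Otherwise the
  sum is a positive multiple of six edge balances, one for each edge of \<open>T\<close> and each
  order of the two remaining vertices.\<close>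

lemma clique5_contribution_nonneg:
  fixes V :: "'a set" and E :: "'a set set" and g :: real
  assumes g: "7*g^2 - 7*g + 1 = 0" "9/11 \<le> g" "g < 1"
    and G: "simple_graph V E" and deg: "\<And>v. v \<in> V \<Longrightarrow> g \<le> nbr_density V E {v}"
    and K: "K \<in> cliques V E 5" and T: "T \<in> cliques V E 3"
  shows "0 \<le> (\<Sum>vs\<in>permutations_of_set K.
    clique_weight V E (take 4 vs) * ordered_clique_gadget vs T)"
proof (cases "T \<subseteq> K")
  case False
  then show ?thesis
    by (intro sum_nonneg)
      (auto simp: permutations_of_set_def ordered_clique_gadget_def edge_gadget_def)
next
  case True
  define R where "R = (\<lambda>S. 1 / nbr_density V E S)"
  have fin: "finite V" using G by (simp add: simple_graph_def)
  have KV: "K \<subseteq> V" "card K = 5" "card T = 3" using K T by (auto simp: cliques_def)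
  have "finite T" using True KV(1) fin by (meson finite_subset)
  then have "card (K - T) = 2" using True KV by (simp add: card_Diff_subset)
  then obtain a b where ab: "K - T = {a, b}" "a \<noteq> b" by (auto simp: card_2_iff)
  obtain x y z where xyz: "T = {x, y, z}" "x \<noteq> y" "x \<noteq> z" "y \<noteq> z"
    using KV(3) by (auto simp: card_3_iff)
  have Keq: "K = {x, y, z, a, b}" using ab xyz True by auto
  have dist: "distinct [x, y, z, a, b]" using ab xyz by auto
  have vert: "{x, y, z, a, b} \<subseteq> V" using KV Keq by simp
  note bal = edge_balance_nonneg[OF g fin _ deg, folded R_def]
  have "(\<Sum>vs\<in>permutations_of_set K. clique_weight V E (take 4 vs) * ordered_clique_gadget vs T)
    = (\<Sum>vs\<in>permutations_of_set K.
        R {vs!0, vs!1} * R {vs!0, vs!1, vs!2} * R {vs!0, vs!1, vs!2, vs!3}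
        * (if (vs!0 \<in> {x, y, z}) = (vs!1 \<in> {x, y, z}) then 1/3 else -1/6) / real (card V) ^ 3)"
  proof (intro sum.cong refl)
    fix vs assume vs: "vs \<in> permutations_of_set K"
    then have set: "set vs = K" "distinct vs" by (auto simp: permutations_of_set_def)
    then have "length vs = 5" using KV(2) distinct_card by metis
    then obtain v0 v1 v2 v3 v4 where eq: "vs = [v0, v1, v2, v3, v4]"
      by (auto simp: numeral_eq_Suc length_Suc_conv)
    have "clique_weight V E (take 4 vs)
        = R {vs!0, vs!1} * R {vs!0, vs!1, vs!2} * R {vs!0, vs!1, vs!2, vs!3} / real (card V) ^ 3"
      using clique_weight_conv[OF G, of v0 v1 v2 v3 v4] K set
      unfolding eq R_def by (simp add: numeral_eq_Suc)
    moreover have "ordered_clique_gadget vs T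
        = (if (vs!0 \<in> T) = (vs!1 \<in> T) then 1/3 else -1/6)"
      using set True \<open>length vs = 5\<close> by (intro ordered_clique_gadget_conv) auto
    ultimately show "clique_weight V E (take 4 vs) * ordered_clique_gadget vs T =
        R {vs!0, vs!1} * R {vs!0, vs!1, vs!2} * R {vs!0, vs!1, vs!2, vs!3}
        * (if (vs!0 \<in> {x, y, z}) = (vs!1 \<in> {x, y, z}) then 1/3 else -1/6) / real (card V) ^ 3"
      by (simp only: xyz(1) times_divide_eq_left)
  qed
  also have "\<dots> = 2 * (edge_balance R x y z a b + edge_balance R x y z b a
      + edge_balance R y z x a b + edge_balance R y z x b a
      + edge_balance R x z y a b + edge_balance R x z y b a) / real (card V) ^ 3"
    unfolding Keq sum_divide_distrib[symmetric] sum_permutations_clique5[OF dist] ..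
  also have "\<dots> \<ge> 0"
    using vert by (intro divide_nonneg_nonneg mult_nonneg_nonneg add_nonneg_nonneg bal) auto
  finally show ?thesis .
qed

section \<open>Nonnegativity for the whole graph\<close>

theorem theorem3p12:
  fixes V :: "'a set" and E :: "'a set set" and d :: real
  assumes "simple_graph V E"
    and "d = (7 - sqrt 21) / 14"
    and "real (min_degree V E) \<ge> (1 - d) * real (card V)"
  shows "\<forall>T \<in> cliques V E 3. triangle_weight V E T \<ge> 0"
proof
  fix T assume T: "T \<in> cliques V E 3"
  define g where "g = 1 - d"
  have geq: "g = (7 + sqrt 21) / 14" using assms(2) by (simp add: g_def field_simps)
  have "7*g^2 - 7*g + 1 = 0" unfolding geq by (simp add: power2_eq_square field_simps)
  moreover have "9/11 \<le> g"
  proof -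
    \<comment> \<open>\<open>9/11 \<le> g\<close> solved for \<open>sqrt 21\<close>; of the two
      roots of the quadratic, \<open>g\<close> is the larger.\<close>
    have "49/11 \<le> sqrt 21" by (rule real_le_rsqrt) (simp add: power2_eq_square)
    then show ?thesis by (simp add: geq)
  qed
  moreover have "g < 1"
  proof -
    have "sqrt 21 < 7" by (rule real_less_lsqrt) auto
    then show ?thesis by (simp add: geq)
  qed
  ultimately have g: "7*g^2 - 7*g + 1 = 0" "9/11 \<le> g" "g < 1" .
  have fin: "finite V" using assms(1) by (simp add: simple_graph_def)
  have deg: "g \<le> nbr_density V E {v}" if "v \<in> V" for v
  proof -
    have "min_degree V E \<le> degree E v" unfolding min_degree_def using fin that by simp
    then have "g * real (card V) \<le> real (card (common_nbrs V E {v}))"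
      using assms(3) degree_eq_card_common_nbrs[OF assms(1), of v] by (simp add: g_def)
    moreover have "0 < card V" using fin that by (auto simp: card_gt_0_iff)
    ultimately show ?thesis by (simp add: nbr_density_def pos_le_divide_eq)
  qed
  show "triangle_weight V E T \<ge> 0"
    unfolding triangle_weight_def sum_ordered_cliques[OF fin]
    by (rule mult_nonneg_nonneg[OF _ sum_nonneg])
      (use clique5_contribution_nonneg[OF g assms(1) deg _ T] in simp_all)
qed

end
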